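(* Let $\Gamma$ be a finite quiver, let $\mathcal{A}_\Gamma$ be its path $*$-algebra, and let $d\ge 0$ be an integer. A linear functional $L_d\colon (\mathcal{A}_\Gamma)_{2d}\to\mathbb{C}$ admits an extension to a positive linear functional $L\colon \mathcal{A}_\Gamma\to\mathbb{C}$ if and only if it admits an extension to a positive linear functional $L_{d+1}\colon (\mathcal{A}_\Gamma)_{2d+2}\to\mathbb{C}$.
   Context: A quiver $\Gamma=(\Gamma_0,\Gamma_1)$ is a directed graph with finite vertex set $\Gamma_0$ and finite arrow set $\Gamma_1$; each arrow $b$ has an origin $o(b)$ and a terminal vertex $t(b)$. The double $\Gamma^*$ has the same vertices and arrows $\Gamma_1\cup\Gamma_1^*$, where $\Gamma_1^*=\{b^*: b\in\Gamma_1\}$ is a disjoint copy of $\Gamma_1$ and $o(b^* )=t(b)$, $t(b^* )=o(b)$. A path in $\Gamma^*$ is a finite sequence of arrows $(b_1,\dots,b_k)$ with $t(b_j)=o(b_{j+1})$; $k$ is its length; for each vertex $e$ there is an empty path of length $0$, also denoted $e$. The path $*$-algebra $\mathcal{A}_\Gamma$ is the complex vector space with basis $\mathcal{B}$ the set of all paths in $\Gamma^*$, with product given by concatenation of paths ($b_1b_2=0$ if $t(b_1)\ne o(b_2)$); its unit is the sum of all vertices. Its involution is the conjugate-linear anti-multiplicative map exchanging $b$ and $b^*$ for $b\in\Gamma_1$ and fixing each vertex $e$. For $t\ge 0$, $(\mathcal{A}_\Gamma)_t$ denotes the linear span of the paths of length at most $t$. A linear functional $L$ on $(\mathcal{A}_\Gamma)_{2t}$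 is positive if $L(ff^* )\ge 0$ for all $f\in(\mathcal{A}_\Gamma)_t$; a linear functional $L$ on $\mathcal{A}_\Gamma$ is positive if $L(ff^* )\ge 0$ for all $f\in\mathcal{A}_\Gamma$. *)

theory Defs
  imports Complex_Main "HOL-Library.Poly_Mapping" "HOL-Library.Nonpos_Ints"
    "Graph_Theory.Digraph" "Graph_Theory.Arc_Walk"
begin

text \<open>
  A finite quiver is a \<^locale>\<open>fin_digraph\<close>: loops and parallel arrows are allowed, the origin of
  an arrow is its \<^const>\<open>tail\<close> and its terminal vertex is its \<^const>\<open>head\<close>. In the double,
  \<open>Inl b\<close> is the arrow \<open>b\<close> and \<open>Inr b\<close> is the arrow \<open>b\<^sup>*\<close>.
\<close>

definition double :: "('v, 'e) pre_digraph \<Rightarrow> ('v, 'e + 'e) pre_digraph" where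
  "double G = \<lparr> verts = verts G,
                arcs = Inl ` arcs G \<union> Inr ` arcs G,
                tail = case_sum (tail G) (head G),
                head = case_sum (head G) (tail G) \<rparr>"

lemma fin_digraph_double:
  assumes "fin_digraph G"
  shows "fin_digraph (double G)"
proof -
  interpret fin_digraph G by fact
  show ?thesis by unfold_locales (auto simp: double_def)
qed

text \<open>
  A path is stored together with its origin, so that \<open>(e, [])\<close> is the empty path at \<open>e\<close>.
\<close>

type_synonym ('v, 'e) path = "'v \<times> ('e + 'e) list"

definition paths :: "('v, 'e) pre_digraph \<Rightarrow> ('v, 'e) path set" where
  "paths G = {(u, p). \<exists>v. pre_digraph.awalk (double G) u p v}"

definition path_end :: "('v, 'e) pre_digraph \<Rightarrow> ('v, 'e) path \<Rightarrow> 'v" where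
  "path_end G x = pre_digraph.awlast (double G) (fst x) (snd x)"

definition path_length :: "('v, 'e) path \<Rightarrow> nat" where
  "path_length x = length (snd x)"

definition path_star :: "('v, 'e) pre_digraph \<Rightarrow> ('v, 'e) path \<Rightarrow> ('v, 'e) path" where
  "path_star G x = (path_end G x, rev (map (case_sum Inr Inl) (snd x)))"

text \<open>
  Elements of the path algebra are finitely supported functions on paths; the path \<open>x\<close> itself is
  \<open>Poly_Mapping.single x 1\<close>.
\<close>

type_synonym ('v, 'e) path_comb = "('v, 'e) path \<Rightarrow>\<^sub>0 complex"

definition cscale :: "complex \<Rightarrow> ('a \<Rightarrow>\<^sub>0 complex) \<Rightarrow> ('a \<Rightarrow>\<^sub>0 complex)" where
  "cscale c f = Poly_Mapping.map ((*) c) f"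

lemma lookup_cscale [simp]: "Poly_Mapping.lookup (cscale c f) x = c * Poly_Mapping.lookup f x"
  by (simp add: cscale_def Poly_Mapping.map.rep_eq when_def)

interpretation path_comb: vector_space "cscale :: complex \<Rightarrow> ('a \<Rightarrow>\<^sub>0 complex) \<Rightarrow> _"
  by unfold_locales (auto intro!: poly_mapping_eqI simp: lookup_add algebra_simps)

definition path_algebra :: "('v, 'e) pre_digraph \<Rightarrow> ('v, 'e) path_comb set" where
  "path_algebra G = {f. Poly_Mapping.keys f \<subseteq> paths G}"

definition path_algebra_upto :: "('v, 'e) pre_digraph \<Rightarrow> nat \<Rightarrow> ('v, 'e) path_comb set" where
  "path_algebra_upto G t =
     path_comb.span ((\<lambda>x. Poly_Mapping.single x 1) ` {x \<in> paths G. path_length x \<le> t})"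

definition path_mult ::
  "('v, 'e) pre_digraph \<Rightarrow> ('v, 'e) path \<Rightarrow> ('v, 'e) path \<Rightarrow> ('v, 'e) path_comb" where
  "path_mult G x y =
     (if path_end G x = fst y then Poly_Mapping.single (fst x, snd x @ snd y) 1 else 0)"

definition alg_mult ::
  "('v, 'e) pre_digraph \<Rightarrow> ('v, 'e) path_comb \<Rightarrow> ('v, 'e) path_comb \<Rightarrow> ('v, 'e) path_comb" where
  "alg_mult G f g =
     (\<Sum>x\<in>Poly_Mapping.keys f. \<Sum>y\<in>Poly_Mapping.keys g.
        cscale (Poly_Mapping.lookup f x * Poly_Mapping.lookup g y) (path_mult G x y))"

definition alg_star :: "('v, 'e) pre_digraph \<Rightarrow> ('v, 'e) path_comb \<Rightarrow> ('v, 'e) path_comb" where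
  "alg_star G f =
     (\<Sum>x\<in>Poly_Mapping.keys f. Poly_Mapping.single (path_star G x) (cnj (Poly_Mapping.lookup f x)))"

text \<open>
  Functionals on a subspace \<open>S\<close> are represented by functions on the whole type, whose values
  outside \<open>S\<close> are irrelevant.
\<close>

definition linear_functional_on ::
  "('a \<Rightarrow>\<^sub>0 complex) set \<Rightarrow> (('a \<Rightarrow>\<^sub>0 complex) \<Rightarrow> complex) \<Rightarrow> bool" where
  "linear_functional_on S L \<longleftrightarrow>
     (\<forall>f\<in>S. \<forall>g\<in>S. L (f + g) = L f + L g) \<and> (\<forall>c. \<forall>f\<in>S. L (cscale c f) = c * L f)"

definition extends_on :: "'a set \<Rightarrow> ('a \<Rightarrow> 'b) \<Rightarrow> ('a \<Rightarrow> 'b) \<Rightarrow> bool" where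
  "extends_on S L L' \<longleftrightarrow> (\<forall>f\<in>S. L f = L' f)"

definition positive_functional ::
  "('v, 'e) pre_digraph \<Rightarrow> (('v, 'e) path_comb \<Rightarrow> complex) \<Rightarrow> bool" where
  "positive_functional G L \<longleftrightarrow>
     linear_functional_on (path_algebra G) L \<and>
     (\<forall>f\<in>path_algebra G. L (alg_mult G f (alg_star G f)) \<in> \<real>\<^sub>\<ge>\<^sub>0)"

text \<open>\<open>positive_functional_upto G t L\<close>: positivity of a functional on paths of length at most \<open>2 * t\<close>.\<close>

definition positive_functional_upto ::
  "('v, 'e) pre_digraph \<Rightarrow> nat \<Rightarrow> (('v, 'e) path_comb \<Rightarrow> complex) \<Rightarrow> bool" where
  "positive_functional_upto G t L \<longleftrightarrow>
     linear_functional_on (path_algebra_upto G (2 * t)) L \<and>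
     (\<forall>f\<in>path_algebra_upto G t. L (alg_mult G f (alg_star G f)) \<in> \<real>\<^sub>\<ge>\<^sub>0)"

lemma path_algebra_upto_iff:
  "f \<in> path_algebra_upto G t \<longleftrightarrow>
     Poly_Mapping.keys f \<subseteq> {x \<in> paths G. path_length x \<le> t}" (is "_ \<longleftrightarrow> _ \<subseteq> ?P")
proof
  have "path_comb.subspace {f :: ('a, 'b) path_comb. Poly_Mapping.keys f \<subseteq> ?P}"
    by (rule path_comb.subspaceI) (auto simp: in_keys_iff lookup_add subset_iff, (metis add_0)+)
  then have "path_algebra_upto G t \<subseteq> {f. Poly_Mapping.keys f \<subseteq> ?P}"
    unfolding path_algebra_upto_def by (rule path_comb.span_minimal[rotated]) auto
  moreover assume "f \<in> path_algebra_upto G t"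
  ultimately show "Poly_Mapping.keys f \<subseteq> ?P" by blast
next
  assume keys: "Poly_Mapping.keys f \<subseteq> ?P"
  have "f = (\<Sum>x\<in>Poly_Mapping.keys f. cscale (Poly_Mapping.lookup f x) (Poly_Mapping.single x 1))"
  proof (rule poly_mapping_eqI)
    fix y
    have "(\<Sum>x\<in>Poly_Mapping.keys f.
             Poly_Mapping.lookup f x * Poly_Mapping.lookup (Poly_Mapping.single x 1) y)
        = (\<Sum>x\<in>Poly_Mapping.keys f. if x = y then Poly_Mapping.lookup f x else 0)"
      by (intro sum.cong) (auto simp: lookup_single)
    then show "Poly_Mapping.lookup f y = Poly_Mapping.lookup
        (\<Sum>x\<in>Poly_Mapping.keys f. cscale (Poly_Mapping.lookup f x) (Poly_Mapping.single x 1)) y"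
      by (simp add: lookup_sum in_keys_iff)
  qed
  also have "\<dots> \<in> path_algebra_upto G t"
    unfolding path_algebra_upto_def using keys
    by (intro path_comb.span_sum path_comb.span_scale path_comb.span_base) auto
  finally show "f \<in> path_algebra_upto G t" .
qed

lemma path_algebra_upto_subset: "path_algebra_upto G t \<subseteq> path_algebra G"
  by (auto simp: path_algebra_upto_iff path_algebra_def)

lemma alg_mult_single:
  "alg_mult G (Poly_Mapping.single x 1) (Poly_Mapping.single y 1) = path_mult G x y"
  by (auto intro!: poly_mapping_eqI simp: alg_mult_def)

lemma alg_star_single:
  "alg_star G (Poly_Mapping.single x c) = Poly_Mapping.single (path_star G x) (cnj c)"
  by (cases "c = 0") (simp_all add: alg_star_def)

lemma path_star_in_paths:
  assumes "fin_digraph G" "x \<in> paths G"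
  shows "path_star G x \<in> paths G" "path_end G (path_star G x) = fst x"
    "path_star G (path_star G x) = x"
proof -
  interpret D: fin_digraph "double G" using assms(1) by (rule fin_digraph_double)
  have arcs: "case_sum Inr Inl b \<in> arcs (double G)" if "b \<in> arcs (double G)" for b
    using that by (auto simp: double_def)
  have ends: "tail (double G) (case_sum Inr Inl b) = head (double G) b"
    "head (double G) (case_sum Inr Inl b) = tail (double G) b" for b
    by (auto simp: double_def split: sum.split)
  have rev_walk: "D.awalk v (rev (map (case_sum Inr Inl) p)) u" if "D.awalk u p v" for u p v
    using that
  proof (induction p arbitrary: u)
    case Nil
    then show ?case by (auto simp: D.awalk_def)
  next
    case (Cons b p)
    from Cons.prems have b: "b \<in> arcs (double G)" and u: "u = tail (double G) b"
      and p: "D.awalk (head (double G) b) p v"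
      by (auto simp: D.awalk_Cons_iff)
    have "D.awalk (head (double G) b) [case_sum Inr Inl b] u"
      using arcs[OF b] b u ends[of b] by (auto simp: D.awalk_def)
    with Cons.IH[OF p] show ?case by (simp add: D.awalk_appendI)
  qed
  obtain u p v where x: "x = (u, p)" and w: "D.awalk u p v"
    using assms(2) by (auto simp: paths_def)
  have v: "path_end G x = v" using w x by (auto simp: path_end_def)
  have w': "D.awalk v (rev (map (case_sum Inr Inl) p)) u" using w by (rule rev_walk)
  show "path_star G x \<in> paths G"
    using w' v x by (auto simp: path_star_def paths_def)
  show e: "path_end G (path_star G x) = fst x"
    using w' v x by (auto simp: path_star_def path_end_def)
  have "case_sum Inr Inl (case_sum Inr Inl b) = b" for b :: "'b + 'b"
    by (cases b) auto
  then show "path_star G (path_star G x) = x"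
    using e v x by (simp add: path_star_def rev_map comp_def)
qed

end

theory Submission
  imports Defs
begin

text \<open>
  The proof is a Gelfand-Naimark-Segal construction. Given a positive \<open>L'\<close> on paths of length at
  most \<open>2 * d + 2\<close>, equip the span of the paths of length at most \<open>d + 1\<close> with the semi-inner
  product \<open>\<langle>f, g\<rangle> = L'(f g\<^sup>*)\<close>, and for an arrow \<open>c\<close> let \<open>X\<^sub>c\<close> be right multiplication by \<open>c\<close>
  followed by the orthogonal projection back onto the span of the paths of length at most \<open>d\<close>.
  Since \<open>X\<^sub>c\<close> and \<open>X\<^bsub>c*\<^esub>\<close> are adjoint, these operators represent the whole path algebra, and on
  paths of length at most \<open>d\<close> starting from the unit vector the projections do nothing. Hence the
  vector functional of the unit is a positive extension of the restriction of \<open>L'\<close> to paths of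
  length at most \<open>2 * d\<close>.
\<close>

section \<open>Positive semidefinite forms\<close>

text \<open>Sesquilinearity is asked of all vectors and only positivity is tied to \<open>V\<close>,
  so algebraic rewriting needs no membership conditions. The form may be degenerate.\<close>

locale psd_form = vector_space scale
  for scale :: "complex \<Rightarrow> 'a::ab_group_add \<Rightarrow> 'a" +
  fixes V :: "'a set" and B :: "'a \<Rightarrow> 'a \<Rightarrow> complex"
  assumes subspace_V: "subspace V"
    and add_left: "B (f + g) h = B f h + B g h"
    and add_right: "B h (f + g) = B h f + B h g"
    and scale_left: "B (scale c f) h = c * B f h"
    and scale_right: "B h (scale c f) = cnj c * B h f"
    and nonneg: "f \<in> V \<Longrightarrow> B f f \<in> \<real>\<^sub>\<ge>\<^sub>0"
begin

lemma diff_left: "B (f - g) h = B f h - B g h"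
  using add_left[of "f - g" g h] by simp

lemma hermitian:
  assumes "f \<in> V" "g \<in> V"
  shows "B g f = cnj (B f g)"
proof -
  have im: "Im (B h h) = 0" if "h \<in> V" for h
    using nonneg[OF that] by (simp add: complex_nonneg_Reals_iff)
  \<comment> \<open>Polarization: \<open>B\<close> is real on the diagonal, so \<open>f + g\<close>
    yields the imaginary part of the claim and \<open>f + scale \<i> g\<close> the real
    part.\<close>
  have "f + g \<in> V" "f + scale \<i> g \<in> V"
    using assms subspace_V by (auto intro: subspace_add subspace_scale)
  from im[OF this(1)] im[OF this(2)] im[OF assms(1)] im[OF assms(2)] show ?thesis
    by (auto simp: add_left add_right scale_left scale_right complex_eq_iff)
qed

text \<open>Makes up for the missing definiteness: in a Gram-Schmidt quotient the numerator vanishes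
  whenever the denominator does.\<close>

lemma null_vector_orthogonal:
  assumes "f \<in> V" "s \<in> V" "B s s = 0"
  shows "B f s = 0"
proof (rule ccontr)
  assume neq: "B f s \<noteq> 0"
  \<comment> \<open>Since \<open>B s s = 0\<close>, the value of the form at
    \<open>f + scale c s\<close> has no quadratic term in \<open>t\<close>; this \<open>t\<close>
    brings its real part down to -1.\<close>
  define t where "t = (Re (B f f) + 1) / (2 * (cmod (B f s))\<^sup>2)"
  define c where "c = - of_real t * B f s"
  have "f + scale c s \<in> V"
    using assms subspace_V by (auto intro: subspace_add subspace_scale)
  then have "0 \<le> Re (B (f + scale c s) (f + scale c s))"
    using nonneg complex_nonneg_Reals_iff by blast
  also have "B (f + scale c s) (f + scale c s) = B f f + cnj c * B f s + c * cnj (B f s)"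
    using hermitian[OF assms(1,2)] assms(3)
    by (simp add: add_left add_right scale_left scale_right)
  also have "\<dots> = B f f - of_real (2 * t * (cmod (B f s))\<^sup>2)"
    unfolding c_def by (simp add: complex_norm_square[of "B f s"] del: of_real_power)
  also have "2 * t * (cmod (B f s))\<^sup>2 = Re (B f f) + 1"
    using neq by (simp add: t_def)
  finally show False by simp
qed

text \<open>Gram-Schmidt by induction on \<open>S\<close>: \<open>f\<close> is projected onto the
  smaller span, then corrected along the part \<open>r\<close> of the new vector \<open>s\<close>
  orthogonal to that span. The induction hypothesis serves for both \<open>s\<close> and
  \<open>f\<close>.\<close>

lemma ex_projection:
  assumes "finite S" "S \<subseteq> V" "f \<in> V"
  shows "\<exists>h\<in>span S. \<forall>g\<in>span S. B (f - h) g = 0"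
  using assms
proof (induction S arbitrary: f rule: finite_induct)
  case empty
  have "B f 0 = 0" using add_right[of f 0 0] by simp
  then show ?case by simp
next
  case (insert s S)
  have span_V: "span S \<subseteq> V"
    using insert.prems(1) subspace_V by (intro span_minimal) auto
  obtain k where k: "k \<in> span S" "\<forall>g\<in>span S. B (s - k) g = 0"
    using insert.IH[of s] insert.prems by auto
  obtain l where l: "l \<in> span S" "\<forall>g\<in>span S. B (f - l) g = 0"
    using insert.IH[of f] insert.prems by auto
  define r where "r = s - k"
  have r: "r \<in> V" and fl: "f - l \<in> V"
    using insert.prems k l span_V subspace_V by (auto simp: r_def intro: subspace_diff)
  \<comment> \<open>If \<open>r\<close> is a null vector, division by zero makes \<open>a = 0\<close>, which is the right coefficient.\<close>
  define a where "a = B (f - l) r / B r r"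
  define h where "h = l + scale a r"
  have span_mono': "x \<in> span (insert s S)" if "x \<in> span S" for x
    using that span_mono[of S "insert s S"] by auto
  have "r \<in> span (insert s S)"
    unfolding r_def using span_mono'[OF k(1)] by (simp add: span_base span_diff)
  then have h: "h \<in> span (insert s S)"
    unfolding h_def by (intro span_add span_scale) (simp_all add: span_mono' l)
  have eq: "B (f - h) g = B (f - l) g - a * B r g" for g
    by (simp add: h_def diff_left add_left scale_left algebra_simps)
  have "B (f - h) r = 0"
    using null_vector_orthogonal[OF fl r] unfolding eq by (cases "B r r = 0") (auto simp: a_def)
  moreover have orth: "B (f - h) g = 0" if "g \<in> span S" for g
    using k(2) l(2) that unfolding eq r_def by simp
  moreover have "B (f - h) s = B (f - h) r + B (f - h) k"
    using add_right[of "f - h" r k] by (simp add: r_def)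
  ultimately have s: "B (f - h) s = 0" using k(1) by simp
  have "B (f - h) g = 0" if "g \<in> span (insert s S)" for g
  proof -
    obtain b where "g - scale b s \<in> span S" using \<open>g \<in> span (insert s S)\<close> by (auto simp: span_insert)
    then have "B (f - h) (g - scale b s + scale b s) = 0"
      unfolding add_right scale_right by (simp add: orth s)
    then show ?thesis by simp
  qed
  with h show ?case by blast
qed

end

section \<open>Linear functionals on path algebras\<close>

definition lin_ext :: "('a \<Rightarrow> ('b \<Rightarrow>\<^sub>0 complex)) \<Rightarrow> ('a \<Rightarrow>\<^sub>0 complex) \<Rightarrow> ('b \<Rightarrow>\<^sub>0 complex)" where
  "lin_ext \<phi> f = (\<Sum>x\<in>Poly_Mapping.keys f. cscale (Poly_Mapping.lookup f x) (\<phi> x))"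

text \<open>The expansion of \<open>f\<close> in the basis of single points; it lets the rules for
  \<open>lin_ext\<close> be applied to an arbitrary \<open>f\<close>.\<close>

lemma lin_ext_single [simp]: "lin_ext (\<lambda>x. Poly_Mapping.single x 1) f = f"
proof (rule poly_mapping_eqI)
  fix y
  have "(\<Sum>x\<in>Poly_Mapping.keys f.
           Poly_Mapping.lookup f x * Poly_Mapping.lookup (Poly_Mapping.single x 1) y)
      = (\<Sum>x\<in>Poly_Mapping.keys f. if x = y then Poly_Mapping.lookup f x else 0)"
    by (intro sum.cong) (auto simp: lookup_single)
  then show "Poly_Mapping.lookup (lin_ext (\<lambda>x. Poly_Mapping.single x 1) f) y
      = Poly_Mapping.lookup f y"
    by (simp add: lin_ext_def lookup_sum in_keys_iff)
qed

lemma subspace_keys: "path_comb.subspace {f :: 'a \<Rightarrow>\<^sub>0 complex. Poly_Mapping.keys f \<subseteq> P}"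
  by (rule path_comb.subspaceI) (auto simp: in_keys_iff lookup_add subset_iff, (metis add_0)+)

lemma lin_ext_in_subspace:
  assumes "path_comb.subspace V" "\<And>x. x \<in> Poly_Mapping.keys f \<Longrightarrow> \<phi> x \<in> V"
  shows "lin_ext \<phi> f \<in> V"
  unfolding lin_ext_def
  by (intro path_comb.subspace_sum path_comb.subspace_scale assms)

lemma linear_functional_on_0:
  assumes "linear_functional_on V L" "path_comb.subspace V"
  shows "L 0 = 0"
proof -
  have "L (cscale 0 0) = 0 * L 0"
    using assms(1) path_comb.subspace_0[OF assms(2)] unfolding linear_functional_on_def by blast
  then show ?thesis by simp
qed

lemma linear_functional_on_sum:
  assumes L: "linear_functional_on V L" and V: "path_comb.subspace V"
    and F: "\<And>i. i \<in> I \<Longrightarrow> F i \<in> V"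
  shows "L (\<Sum>i\<in>I. F i) = (\<Sum>i\<in>I. L (F i))"
  using F
proof (induction I rule: infinite_finite_induct)
  case (insert i I)
  then have "(\<Sum>i\<in>I. F i) \<in> V" by (intro path_comb.subspace_sum V) auto
  with insert L show ?case by (auto simp: linear_functional_on_def)
qed (simp_all add: linear_functional_on_0[OF L V])

lemma linear_functional_on_lin_ext:
  assumes "linear_functional_on V L" "path_comb.subspace V"
    and "\<And>x. x \<in> Poly_Mapping.keys f \<Longrightarrow> \<phi> x \<in> V"
  shows "L (lin_ext \<phi> f)
       = (\<Sum>x\<in>Poly_Mapping.keys f. Poly_Mapping.lookup f x * L (\<phi> x))"
proof -
  have "L (lin_ext \<phi> f)
      = (\<Sum>x\<in>Poly_Mapping.keys f. L (cscale (Poly_Mapping.lookup f x) (\<phi> x)))"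
    unfolding lin_ext_def using assms
    by (intro linear_functional_on_sum[where V = V]) (auto intro: path_comb.subspace_scale)
  also have "\<dots> = (\<Sum>x\<in>Poly_Mapping.keys f. Poly_Mapping.lookup f x * L (\<phi> x))"
    using assms(1,3) by (intro sum.cong) (auto simp: linear_functional_on_def)
  finally show ?thesis .
qed

text \<open>Supports can shrink under addition and scaling, so linearity is proved by summing over a
  common finite superset.\<close>

lemma lin_ext_superset:
  assumes "finite X" "Poly_Mapping.keys f \<subseteq> X"
  shows "lin_ext \<phi> f = (\<Sum>x\<in>X. cscale (Poly_Mapping.lookup f x) (\<phi> x))"
  unfolding lin_ext_def using assms
  by (intro sum.mono_neutral_left) (auto simp: in_keys_iff)

lemma lin_ext_add: "lin_ext \<phi> (f + g) = lin_ext \<phi> f + lin_ext \<phi> g"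
proof -
  let ?X = "Poly_Mapping.keys f \<union> Poly_Mapping.keys g"
  have "Poly_Mapping.keys (f + g) \<subseteq> ?X" by (rule Poly_Mapping.keys_add)
  then show ?thesis
    by (simp add: lin_ext_superset[of ?X] lookup_add path_comb.scale_left_distrib sum.distrib)
qed

lemma keys_cscale: "Poly_Mapping.keys (cscale c f) \<subseteq> Poly_Mapping.keys f"
  by (auto simp: in_keys_iff)

lemma lin_ext_cscale: "lin_ext \<phi> (cscale c f) = cscale c (lin_ext \<phi> f)"
  by (simp add: lin_ext_superset[of "Poly_Mapping.keys f"] keys_cscale
      path_comb.scale_sum_right)

section \<open>Sesquilinear forms and moment matrices\<close>

text \<open>\<open>M\<close> is the Gram matrix of the form on the basis; the form is
  conjugate-linear in its second argument.\<close>

definition sform ::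
  "('a \<Rightarrow> 'a \<Rightarrow> complex) \<Rightarrow> ('a \<Rightarrow>\<^sub>0 complex) \<Rightarrow> ('a \<Rightarrow>\<^sub>0 complex) \<Rightarrow> complex" where
  "sform M f g = (\<Sum>x\<in>Poly_Mapping.keys f. \<Sum>y\<in>Poly_Mapping.keys g.
     Poly_Mapping.lookup f x * cnj (Poly_Mapping.lookup g y) * M x y)"

lemma sform_superset:
  assumes "finite X" "Poly_Mapping.keys f \<subseteq> X" "finite Y" "Poly_Mapping.keys g \<subseteq> Y"
  shows "sform M f g = (\<Sum>x\<in>X. \<Sum>y\<in>Y.
     Poly_Mapping.lookup f x * cnj (Poly_Mapping.lookup g y) * M x y)"
proof -
  have "sform M f g = (\<Sum>x\<in>Poly_Mapping.keys f. \<Sum>y\<in>Y.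
     Poly_Mapping.lookup f x * cnj (Poly_Mapping.lookup g y) * M x y)"
    unfolding sform_def using assms
    by (intro sum.cong sum.mono_neutral_left) (auto simp: in_keys_iff)
  also have "\<dots> = (\<Sum>x\<in>X. \<Sum>y\<in>Y.
     Poly_Mapping.lookup f x * cnj (Poly_Mapping.lookup g y) * M x y)"
    using assms by (intro sum.mono_neutral_left) (auto simp: in_keys_iff)
  finally show ?thesis .
qed

lemma sform_add_left: "sform M (f + g) h = sform M f h + sform M g h"
proof -
  let ?X = "Poly_Mapping.keys f \<union> Poly_Mapping.keys g"
  have "Poly_Mapping.keys (f + g) \<subseteq> ?X" by (rule Poly_Mapping.keys_add)
  then show ?thesis
    by (simp add: sform_superset[of ?X _ "Poly_Mapping.keys h"] lookup_add
        distrib_right sum.distrib)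
qed

lemma sform_add_right: "sform M h (f + g) = sform M h f + sform M h g"
proof -
  let ?X = "Poly_Mapping.keys f \<union> Poly_Mapping.keys g"
  have "Poly_Mapping.keys (f + g) \<subseteq> ?X" by (rule Poly_Mapping.keys_add)
  then show ?thesis
    by (simp add: sform_superset[of "Poly_Mapping.keys h" _ ?X] lookup_add
        distrib_right distrib_left sum.distrib)
qed

lemma sform_cscale_left: "sform M (cscale c f) h = c * sform M f h"
  by (simp add: sform_superset[of "Poly_Mapping.keys f" _ "Poly_Mapping.keys h"] keys_cscale
      sum_distrib_left mult.assoc)

lemma sform_cscale_right: "sform M h (cscale c f) = cnj c * sform M h f"
  by (simp add: sform_superset[of "Poly_Mapping.keys h" _ "Poly_Mapping.keys f"] keys_cscale
      sum_distrib_left mult_ac)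

lemma sform_single: "sform M (Poly_Mapping.single x 1) (Poly_Mapping.single y 1) = M x y"
  by (simp add: sform_def)

lemma sform_sum_left: "sform M (\<Sum>i\<in>I. F i) h = (\<Sum>i\<in>I. sform M (F i) h)"
  by (induction I rule: infinite_finite_induct) (simp_all add: sform_add_left, simp_all add: sform_def)

lemma sform_sum_right: "sform M h (\<Sum>i\<in>I. F i) = (\<Sum>i\<in>I. sform M h (F i))"
  by (induction I rule: infinite_finite_induct) (simp_all add: sform_add_right, simp_all add: sform_def)

text \<open>Pulling a form back along linear maps only changes its Gram matrix, so identities
  between forms reduce to basis elements.\<close>

lemma sform_lin_ext:
  "sform M (lin_ext \<phi> f) (lin_ext \<psi> g) = sform (\<lambda>x y. sform M (\<phi> x) (\<psi> y)) f g"
proof -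
  have "sform M (lin_ext \<phi> f) (lin_ext \<psi> g) =
      (\<Sum>x\<in>Poly_Mapping.keys f. \<Sum>y\<in>Poly_Mapping.keys g. Poly_Mapping.lookup f x *
         (cnj (Poly_Mapping.lookup g y) * sform M (\<phi> x) (\<psi> y)))"
    unfolding lin_ext_def sform_sum_left
    by (simp add: sform_sum_right sform_cscale_left sform_cscale_right sum_distrib_left
        mult.left_commute)
  then show ?thesis by (simp add: sform_def[of _ f g] mult.assoc)
qed

lemma sform_cong:
  assumes "\<And>x y. x \<in> Poly_Mapping.keys f \<Longrightarrow> y \<in> Poly_Mapping.keys g \<Longrightarrow> M x y = N x y"
  shows "sform M f g = sform N f g"
  unfolding sform_def using assms by (intro sum.cong) auto

text \<open>The moment matrix of \<open>L\<close>, with entries \<open>L\<close> of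
  \<open>x y\<^sup>*\<close>.\<close>

definition moment ::
  "('v, 'e) pre_digraph \<Rightarrow> (('v, 'e) path_comb \<Rightarrow> complex) \<Rightarrow>
     ('v, 'e) path \<Rightarrow> ('v, 'e) path \<Rightarrow> complex" where
  "moment G L x y = L (path_mult G x (path_star G y))"

text \<open>Translates positivity on squares into positivity of the moment matrix. As
  \<open>L\<close> is linear only on \<open>V\<close>, every product of paths that occurs has to lie
  in \<open>V\<close>.\<close>

lemma linear_functional_mult_star:
  fixes G :: "('v, 'e) pre_digraph"
  assumes G: "fin_digraph G" and L: "linear_functional_on V L" and V: "path_comb.subspace V"
    and g: "g \<in> path_algebra G"
    and mult: "\<And>x y. x \<in> Poly_Mapping.keys f \<Longrightarrow> y \<in> Poly_Mapping.keys g \<Longrightarrow>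
      path_mult G x (path_star G y) \<in> V"
  shows "L (alg_mult G f (alg_star G g)) = sform (moment G L) f g"
proof -
  have g_paths: "Poly_Mapping.keys g \<subseteq> paths G" using g by (simp add: path_algebra_def)
  \<comment> \<open>No two paths of \<open>g\<close> share a star, so coefficients do not merge in
    \<open>alg_star G g\<close> and the sum can be reindexed by the paths of
    \<open>g\<close>.\<close>
  have inj: "inj_on (path_star G) (Poly_Mapping.keys g)"
    using path_star_in_paths(3)[OF G] g_paths by (metis inj_on_def subsetD)
  have lookup_star: "Poly_Mapping.lookup (alg_star G g) (path_star G y)
      = cnj (Poly_Mapping.lookup g y)" if "y \<in> Poly_Mapping.keys g" for y
  proof -
    have "Poly_Mapping.lookup (alg_star G g) (path_star G y)
        = (\<Sum>z\<in>Poly_Mapping.keys g. if z = y then cnj (Poly_Mapping.lookup g y) else 0)"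
      unfolding alg_star_def lookup_sum using inj that
      by (intro sum.cong) (auto simp: lookup_single when_def dest: inj_onD)
    then show ?thesis using that by simp
  qed
  have keys_star: "Poly_Mapping.keys (alg_star G g) \<subseteq> path_star G ` Poly_Mapping.keys g"
    unfolding alg_star_def by (rule order_trans[OF keys_sum]) (auto split: if_splits)
  have "alg_mult G f (alg_star G g) =
      (\<Sum>x\<in>Poly_Mapping.keys f. \<Sum>z\<in>path_star G ` Poly_Mapping.keys g.
         cscale (Poly_Mapping.lookup f x * Poly_Mapping.lookup (alg_star G g) z)
           (path_mult G x z))"
    unfolding alg_mult_def using keys_star
    by (intro sum.cong[OF refl, of "Poly_Mapping.keys f"] sum.mono_neutral_left)
       (auto simp: in_keys_iff intro!: poly_mapping_eqI)
  also have "\<dots> = (\<Sum>x\<in>Poly_Mapping.keys f. \<Sum>y\<in>Poly_Mapping.keys g.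
         cscale (Poly_Mapping.lookup f x * cnj (Poly_Mapping.lookup g y))
           (path_mult G x (path_star G y)))"
    by (simp add: sum.reindex[OF inj] lookup_star)
  also have "L \<dots> = (\<Sum>x\<in>Poly_Mapping.keys f. \<Sum>y\<in>Poly_Mapping.keys g.
         L (cscale (Poly_Mapping.lookup f x * cnj (Poly_Mapping.lookup g y))
           (path_mult G x (path_star G y))))"
    using mult V
    by (subst linear_functional_on_sum[OF L V])
       (auto intro!: sum.cong linear_functional_on_sum[OF L V] path_comb.subspace_sum
         path_comb.subspace_scale)
  also have "\<dots> = sform (moment G L) f g"
    unfolding sform_def moment_def using L mult
    by (intro sum.cong refl) (auto simp: linear_functional_on_def)
  finally show ?thesis .
qed


section \<open>Paths in the double\<close>

abbreviation (input) arc_star :: "'e + 'e \<Rightarrow> 'e + 'e" where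
  "arc_star \<equiv> case_sum Inr Inl"

lemma arc_star_arc_star [simp]: "arc_star (arc_star c) = c"
  by (cases c) auto

lemma double_arc_star:
  "tail (double G) (arc_star c) = head (double G) c"
  "head (double G) (arc_star c) = tail (double G) c"
  "arc_star c \<in> arcs (double G) \<longleftrightarrow> c \<in> arcs (double G)"
  by (auto simp: double_def split: sum.split)

text \<open>Holds for arbitrary lists of arrows, walks or not, so the simplification rules drawn
  from it carry no side conditions.\<close>

lemma path_end_conv: "path_end G (u, p) = (if p = [] then u else head (double G) (last p))"
proof (induction p arbitrary: u)
  case (Cons c p)
  have "pre_digraph.awalk_verts (double G) (head (double G) c) p \<noteq> []"
    by (cases p) (simp_all add: pre_digraph.awalk_verts.simps)
  with Cons[of "head (double G) c"] show ?case
    by (auto simp: path_end_def pre_digraph.awalk_verts.simps)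
qed (simp add: path_end_def pre_digraph.awalk_verts.simps)

lemma path_end_simps [simp]:
  "path_end G (u, []) = u"
  "path_end G (u, p @ [c]) = head (double G) c"
  by (simp_all add: path_end_conv)

context
  fixes G :: "('v, 'e) pre_digraph"
  assumes fin: "fin_digraph G"
begin

lemma paths_append_iff:
  "(u, p @ q) \<in> paths G \<longleftrightarrow> (u, p) \<in> paths G \<and> (path_end G (u, p), q) \<in> paths G"
proof -
  interpret D: fin_digraph "double G" using fin by (rule fin_digraph_double)
  show ?thesis by (auto simp: paths_def path_end_def)
qed

lemma paths_arc_iff: "(u, [c]) \<in> paths G \<longleftrightarrow> c \<in> arcs (double G) \<and> u = tail (double G) c"
proof -
  interpret D: fin_digraph "double G" using fin by (rule fin_digraph_double)
  show ?thesis by (auto simp: paths_def D.awalk_simps)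
qed

lemma paths_snoc_iff:
  "(u, p @ [c]) \<in> paths G \<longleftrightarrow>
     (u, p) \<in> paths G \<and> c \<in> arcs (double G) \<and> path_end G (u, p) = tail (double G) c"
  by (auto simp: paths_append_iff paths_arc_iff)

lemma path_mult_star_in:
  assumes "x \<in> paths G" "y \<in> paths G" "path_length x + path_length y \<le> t"
  shows "path_mult G x (path_star G y) \<in> path_algebra_upto G t"
  using assms paths_append_iff[of "fst x" "snd x" "snd (path_star G y)"]
    path_star_in_paths(1)[OF fin assms(2)]
  by (auto simp: path_mult_def path_algebra_upto_iff path_length_def path_star_def)

text \<open>Supplies the finite spanning sets needed for \<open>ex_projection\<close>.\<close>

lemma finite_short_paths: "finite {x \<in> paths G. path_length x \<le> t}"
proof -
  interpret D: fin_digraph "double G" using fin by (rule fin_digraph_double)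
  have "{x \<in> paths G. path_length x \<le> t}
      \<subseteq> verts (double G) \<times> {p. set p \<subseteq> arcs (double G) \<and> length p \<le> t}"
    by (auto simp: paths_def path_length_def D.awalk_def)
  moreover have "finite (verts (double G) \<times> {p. set p \<subseteq> arcs (double G) \<and> length p \<le> t})"
    by (intro finite_cartesian_product finite_lists_length_le D.finite_verts D.finite_arcs)
  ultimately show ?thesis by (rule finite_subset)
qed

end

section \<open>The compressed multiplication operators\<close>

locale truncated_functional =
  fixes G :: "('v, 'e) pre_digraph" and d :: nat and L :: "('v, 'e) path_comb \<Rightarrow> complex"
  assumes fin: "fin_digraph G" and pos: "positive_functional_upto G (d + 1) L"
begin

abbreviation form :: "('v, 'e) path_comb \<Rightarrow> ('v, 'e) path_comb \<Rightarrow> complex" where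
  "form \<equiv> sform (moment G L)"

lemma linear: "linear_functional_on (path_algebra_upto G (2 * (d + 1))) L"
  using pos by (simp add: positive_functional_upto_def)

lemma subspace_upto: "path_comb.subspace (path_algebra_upto G t)"
  by (simp add: path_algebra_upto_def)

text \<open>Two paths of length at most \<open>d + 1\<close> multiply to length at most
  \<open>2 * (d + 1)\<close>, where \<open>L\<close> is linear, so positivity of \<open>L\<close> is
  positivity of \<open>form\<close>.\<close>

sublocale psd_form cscale "path_algebra_upto G (d + 1)" form
proof unfold_locales
  fix f assume f: "f \<in> path_algebra_upto G (d + 1)"
  have "L (alg_mult G f (alg_star G f)) = form f f"
  proof (rule linear_functional_mult_star[OF fin linear subspace_upto])
    show "f \<in> path_algebra G" using f path_algebra_upto_subset by blast
    fix x y assume "x \<in> Poly_Mapping.keys f" "y \<in> Poly_Mapping.keys f"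
    with f have "x \<in> paths G" "y \<in> paths G" "path_length x \<le> d + 1" "path_length y \<le> d + 1"
      by (auto simp: path_algebra_upto_iff)
    then show "path_mult G x (path_star G y) \<in> path_algebra_upto G (2 * (d + 1))"
      by (intro path_mult_star_in[OF fin]) simp_all
  qed
  moreover have "L (alg_mult G f (alg_star G f)) \<in> \<real>\<^sub>\<ge>\<^sub>0"
    using pos f by (simp add: positive_functional_upto_def)
  ultimately show "form f f \<in> \<real>\<^sub>\<ge>\<^sub>0" by simp
qed (auto simp: subspace_upto sform_add_left sform_add_right sform_cscale_left sform_cscale_right)

section \<open>Short paths by end vertex and the operators between them\<close>

text \<open>Splitting by end vertex gives mutually orthogonal summands; the operator of an arrow
  goes from the summand at its tail to the one at its head.\<close>

definition ending_at :: "'v \<Rightarrow> ('v, 'e) path_comb set" where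
  "ending_at e = {f. Poly_Mapping.keys f \<subseteq> {x \<in> paths G. path_length x \<le> d \<and> path_end G x = e}}"

text \<open>Composability is not tested, so this is right multiplication by \<open>c\<close> only on
  combinations of paths ending at the tail of \<open>c\<close>.\<close>

definition append_arc :: "'e + 'e \<Rightarrow> ('v, 'e) path_comb \<Rightarrow> ('v, 'e) path_comb" where
  "append_arc c = lin_ext (\<lambda>x. Poly_Mapping.single (fst x, snd x @ [c]) 1)"

text \<open>
  The projection is unique only modulo null vectors; the choice keeps short paths unchanged.
\<close>

definition step :: "'e + 'e \<Rightarrow> ('v, 'e) path_comb \<Rightarrow> ('v, 'e) path_comb" where
  "step c f = (SOME h. h \<in> ending_at (head (double G) c) \<and>
     (\<forall>g\<in>ending_at (head (double G) c). form h g = form (append_arc c f) g) \<and>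
     (append_arc c f \<in> ending_at (head (double G) c) \<longrightarrow> h = append_arc c f))"

text \<open>The image of the origin, as an empty path, under the operators of the arrows of
  \<open>x\<close> in order.\<close>

definition represent :: "('v, 'e) path \<Rightarrow> ('v, 'e) path_comb" where
  "represent x = foldl (\<lambda>f c. step c f) (Poly_Mapping.single (fst x, []) 1) (snd x)"

lemma subspace_ending_at: "path_comb.subspace (ending_at e)"
  unfolding ending_at_def by (rule subspace_keys)

lemma ending_at_upto: "ending_at e \<subseteq> path_algebra_upto G (d + 1)"
  by (fastforce simp: ending_at_def path_algebra_upto_iff)

lemma span_short_paths:
  "path_comb.span ((\<lambda>x. Poly_Mapping.single x 1) `
     {x \<in> paths G. path_length x \<le> d \<and> path_end G x = e}) = ending_at e" (is "path_comb.span ?S = _")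
proof
  show "path_comb.span ?S \<subseteq> ending_at e"
    by (rule path_comb.span_minimal[OF _ subspace_ending_at]) (auto simp: ending_at_def)
  show "ending_at e \<subseteq> path_comb.span ?S"
  proof
    fix f assume "f \<in> ending_at e"
    then have "lin_ext (\<lambda>x. Poly_Mapping.single x 1) f \<in> path_comb.span ?S"
      by (intro lin_ext_in_subspace path_comb.span_base) (auto simp: ending_at_def)
    then show "f \<in> path_comb.span ?S" by simp
  qed
qed

text \<open>The extra degree is used here: appending an arrow leads from length \<open>d\<close> to
  \<open>d + 1\<close>, still inside the space where \<open>form\<close> is positive.\<close>

lemma append_arc_upto:
  assumes "c \<in> arcs (double G)" "f \<in> ending_at (tail (double G) c)"
  shows "append_arc c f \<in> path_algebra_upto G (d + 1)"
  unfolding append_arc_def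
proof (rule lin_ext_in_subspace[OF subspace_upto])
  fix x assume "x \<in> Poly_Mapping.keys f"
  then have "(fst x, snd x @ [c]) \<in> paths G" "path_length x \<le> d"
    using assms paths_snoc_iff[OF fin, of "fst x" "snd x"] by (auto simp: ending_at_def)
  then show "Poly_Mapping.single (fst x, snd x @ [c]) 1 \<in> path_algebra_upto G (d + 1)"
    by (auto simp: path_algebra_upto_iff path_length_def)
qed

lemma step:
  assumes "c \<in> arcs (double G)" "f \<in> ending_at (tail (double G) c)"
  shows "step c f \<in> ending_at (head (double G) c)"
    and "g \<in> ending_at (head (double G) c) \<Longrightarrow> form (step c f) g = form (append_arc c f) g"
    and "append_arc c f \<in> ending_at (head (double G) c) \<Longrightarrow> step c f = append_arc c f"
proof -
  let ?e = "head (double G) c"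
  let ?S = "(\<lambda>x. Poly_Mapping.single x 1) `
     {x \<in> paths G. path_length x \<le> d \<and> path_end G x = ?e} :: ('v, 'e) path_comb set"
  have "\<exists>h\<in>ending_at ?e. \<forall>g\<in>ending_at ?e. form (append_arc c f - h) g = 0"
    unfolding span_short_paths[symmetric]
  proof (rule ex_projection)
    show "finite ?S"
      by (intro finite_imageI finite_subset[OF _ finite_short_paths[OF fin, of d]]) auto
    show "?S \<subseteq> path_algebra_upto G (d + 1)"
      by (auto simp: path_algebra_upto_iff)
  qed (rule append_arc_upto[OF assms])
  then have "\<exists>h. h \<in> ending_at ?e \<and>
     (\<forall>g\<in>ending_at ?e. form h g = form (append_arc c f) g) \<and>
     (append_arc c f \<in> ending_at ?e \<longrightarrow> h = append_arc c f)"
    \<comment> \<open>If the appended vector is already short it is its own witness; otherwise the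
      projection is, and the last condition is vacuous.\<close>
    by (cases "append_arc c f \<in> ending_at ?e") (auto simp: diff_left)
  from someI_ex[OF this, folded step_def]
  show "step c f \<in> ending_at ?e"
    and "g \<in> ending_at ?e \<Longrightarrow> form (step c f) g = form (append_arc c f) g"
    and "append_arc c f \<in> ending_at ?e \<Longrightarrow> step c f = append_arc c f"
    by auto
qed

lemma represent_snoc: "represent (u, p @ [c]) = step c (represent (u, p))"
  by (simp add: represent_def)

lemma represent_ending_at: "x \<in> paths G \<Longrightarrow> represent x \<in> ending_at (path_end G x)"
proof (cases x)
  case (Pair u p)
  assume "x \<in> paths G"
  then show ?thesis unfolding Pair
  proof (induction p rule: rev_induct)
    case Nil
    then show ?case by (auto simp: represent_def ending_at_def path_length_def)
  next
    case (snoc c p)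
    then show ?case
      using step(1)[of c "represent (u, p)"]
      by (auto simp: represent_snoc paths_snoc_iff[OF fin])
  qed
qed

text \<open>All prefixes of \<open>x\<close> have length at most \<open>d\<close>, so each appended
  vector stays in the target space and no projection changes it.\<close>

lemma represent_short:
  assumes "x \<in> paths G" "path_length x \<le> d"
  shows "represent x = Poly_Mapping.single x 1"
proof (cases x)
  case (Pair u p)
  show ?thesis using assms unfolding Pair
  proof (induction p rule: rev_induct)
    case Nil
    then show ?case by (simp add: represent_def)
  next
    case (snoc c p)
    then have IH: "represent (u, p) = Poly_Mapping.single (u, p) 1"
      and c: "c \<in> arcs (double G)" "path_end G (u, p) = tail (double G) c"
      and p: "(u, p) \<in> paths G"
      by (auto simp: path_length_def paths_snoc_iff[OF fin])
    have eq: "append_arc c (represent (u, p)) = Poly_Mapping.single (u, p @ [c]) 1"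
      by (auto simp: IH append_arc_def lin_ext_def intro!: poly_mapping_eqI)
    have "step c (represent (u, p)) = append_arc c (represent (u, p))"
      using represent_ending_at[OF p] c snoc.prems
      by (intro step(3)) (auto simp: eq ending_at_def)
    then show ?case by (simp add: represent_snoc eq)
  qed
qed

section \<open>Adjointness of the compressed operators\<close>

lemma form_append_arc:
  assumes "f \<in> ending_at (tail (double G) c)" "g \<in> ending_at (head (double G) c)"
  shows "form (append_arc c f) g = form f (append_arc (arc_star c) g)"
proof -
  let ?s = "\<lambda>x. Poly_Mapping.single x (1 :: complex)"
  let ?a = "\<lambda>c x. ?s (fst x, snd x @ [c])"
  have "form (append_arc c f) g = form (lin_ext (?a c) f) (lin_ext ?s g)"
    by (simp add: append_arc_def)
  also have "\<dots> = sform (\<lambda>x y. form (?a c x) (?s y)) f g"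
    by (rule sform_lin_ext)
  also have "\<dots> = sform (\<lambda>x y. form (?s x) (?a (arc_star c) y)) f g"
    using assms unfolding sform_single
    by (intro sform_cong)
       (auto simp: ending_at_def subset_iff moment_def path_mult_def path_star_def
         double_arc_star)
  also have "\<dots> = form (lin_ext ?s f) (lin_ext (?a (arc_star c)) g)"
    by (rule sform_lin_ext[symmetric])
  also have "\<dots> = form f (append_arc (arc_star c) g)"
    by (simp add: append_arc_def)
  finally show ?thesis .
qed

text \<open>A vertex is its own star and a right unit for paths ending there, so pairing with it
  recovers \<open>L\<close>.\<close>

lemma form_vertex:
  assumes "f \<in> ending_at e"
  shows "form f (Poly_Mapping.single (e, []) 1) = L f"
proof -
  have "form f (Poly_Mapping.single (e, []) 1)
      = (\<Sum>x\<in>Poly_Mapping.keys f. Poly_Mapping.lookup f x * L (Poly_Mapping.single x 1))"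
    using assms unfolding sform_def
    by (auto simp: moment_def path_mult_def path_star_def ending_at_def subset_iff intro!: sum.cong)
  also have "\<dots> = L (lin_ext (\<lambda>x. Poly_Mapping.single x 1) f)"
    using assms
    by (intro linear_functional_on_lin_ext[OF linear subspace_upto, symmetric])
       (auto simp: ending_at_def path_algebra_upto_iff)
  finally show ?thesis by simp
qed

text \<open>
  Compressions of adjoint operators are adjoint to each other, so that the arrows of \<open>y\<close> can be
  moved one by one to the other side.
\<close>

lemma form_represent:
  assumes "x \<in> paths G" "y \<in> paths G" "path_end G x = path_end G y"
  shows "form (represent x) (represent y)
       = L (represent (fst x, snd x @ snd (path_star G y)))"
proof -
  obtain u p where x: "x = (u, p)" by (cases x)
  obtain v q where y: "y = (v, q)" by (cases y)
  have "form (represent (u, p)) (represent (v, q))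
       = L (represent (u, p @ rev (map arc_star q)))"
    using assms unfolding x y
  \<comment> \<open>The last arrow of \<open>q\<close> is starred and appended to \<open>p\<close>,
    so \<open>p\<close> must vary.\<close>
  proof (induction q arbitrary: p rule: rev_induct)
    case Nil
    then show ?case
      using form_vertex[of "represent (u, p)" v] represent_ending_at[of "(u, p)"] Nil
      by (simp add: represent_def[of "(v, [])"])
  next
    case (snoc c q)
    let ?f = "represent (u, p)" and ?g = "represent (v, q)"
    from snoc.prems have c: "c \<in> arcs (double G)" "path_end G (v, q) = tail (double G) c"
      and q: "(v, q) \<in> paths G" and p: "path_end G (u, p) = head (double G) c"
      by (auto simp: paths_snoc_iff[OF fin])
    have pc: "(u, p @ [arc_star c]) \<in> paths G"
      using snoc.prems(1) c(1) p by (simp add: paths_snoc_iff[OF fin] double_arc_star)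
    have f: "?f \<in> ending_at (head (double G) c)" and g: "?g \<in> ending_at (tail (double G) c)"
      using represent_ending_at snoc.prems(1) q p c by metis+
    have upto: "?f \<in> path_algebra_upto G (d + 1)" "step c ?g \<in> path_algebra_upto G (d + 1)"
      using f step(1)[OF c(1) g] ending_at_upto by auto
    \<comment> \<open>The defining property of \<open>step\<close> removes the projection only in
      the first argument, hence the detour through Hermitian symmetry.\<close>
    have "form ?f (step c ?g) = cnj (form (step c ?g) ?f)"
      by (rule hermitian[OF upto(2,1)])
    also have "\<dots> = cnj (form (append_arc c ?g) ?f)"
      by (simp add: step(2)[OF c(1) g f])
    also have "\<dots> = form ?f (append_arc c ?g)"
      using upto(1) append_arc_upto[OF c(1) g] by (simp add: hermitian[of "append_arc c ?g" ?f])
    also have "\<dots> = form (append_arc (arc_star c) ?f) ?g"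
      using form_append_arc[of ?f "arc_star c" ?g] f g by (simp add: double_arc_star)
    \<comment> \<open>The projection can be put back because \<open>?g\<close> lies in the target
      space of the operator of \<open>arc_star c\<close>.\<close>
    also have "\<dots> = form (step (arc_star c) ?f) ?g"
      using step(2)[of "arc_star c" ?f ?g] c f g by (simp add: double_arc_star)
    also have "\<dots> = L (represent (u, (p @ [arc_star c]) @ rev (map arc_star q)))"
      unfolding represent_snoc[symmetric] using pc q c(2)
      by (intro snoc.IH) (simp_all add: double_arc_star)
    finally show ?case by (simp add: represent_snoc)
  qed
  then show ?thesis by (simp add: x y path_star_def)
qed

text \<open>Paths \<open>x\<close> and \<open>y\<close> with different ends satisfy
  \<open>x y\<^sup>* = 0\<close>.\<close>

lemma form_different_ends:
  assumes "f \<in> ending_at a" "g \<in> ending_at b" "a \<noteq> b"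
  shows "form f g = 0"
proof -
  have "form f g = sform (\<lambda>x y. 0) f g"
    using assms linear_functional_on_0[OF linear subspace_upto]
    by (intro sform_cong)
       (auto simp: ending_at_def moment_def path_mult_def path_star_def subset_iff)
  then show ?thesis by (simp add: sform_def)
qed

section \<open>The vector functional of the unit\<close>

text \<open>On combinations of short paths, applying \<open>L\<close> is pairing with the sum of all
  vertices, by \<open>form_vertex\<close> and \<open>form_different_ends\<close>.\<close>

definition extension :: "('v, 'e) path_comb \<Rightarrow> complex" where
  "extension f = L (lin_ext represent f)"

lemma represent_upto:
  assumes "x \<in> paths G" "d \<le> t"
  shows "represent x \<in> path_algebra_upto G t"
  using represent_ending_at[OF assms(1)] assms(2)
  by (fastforce simp: ending_at_def path_algebra_upto_iff)

lemma lin_ext_represent_upto: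
  assumes "f \<in> path_algebra G" "d \<le> t"
  shows "lin_ext represent f \<in> path_algebra_upto G t"
  using assms
  by (intro lin_ext_in_subspace subspace_upto represent_upto) (auto simp: path_algebra_def)

lemma extension_linear: "linear_functional_on (path_algebra G) extension"
  using linear lin_ext_represent_upto[of _ "2 * (d + 1)"]
  by (simp add: linear_functional_on_def extension_def lin_ext_add lin_ext_cscale)

text \<open>Exhibits the infinite moment matrix of \<open>extension\<close> as the Gram matrix of
  the vectors \<open>represent x\<close>.\<close>

lemma moment_extension:
  assumes "x \<in> paths G" "y \<in> paths G"
  shows "moment G extension x y = form (represent x) (represent y)"
proof (cases "path_end G x = path_end G y")
  case True
  then have "path_mult G x (path_star G y)
      = Poly_Mapping.single (fst x, snd x @ snd (path_star G y)) 1"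
    by (simp add: path_mult_def path_star_def)
  moreover have "lin_ext represent (Poly_Mapping.single z 1) = represent z" for z
    by (simp add: lin_ext_def)
  ultimately show ?thesis
    using form_represent[OF assms True] by (simp add: moment_def extension_def)
next
  case False
  have "L 0 = 0" by (rule linear_functional_on_0[OF linear subspace_upto])
  with False show ?thesis
    using form_different_ends[OF represent_ending_at represent_ending_at] assms
    by (simp add: moment_def extension_def path_mult_def path_star_def lin_ext_def)
qed

text \<open>The value at \<open>f f\<^sup>*\<close> is the form on the diagonal at
  \<open>lin_ext represent f\<close>, a vector in the space where the form is positive.\<close>

lemma extension_positive: "positive_functional G extension"
  unfolding positive_functional_def
proof (intro conjI ballI extension_linear)
  fix f assume f: "f \<in> path_algebra G"
  have "extension (alg_mult G f (alg_star G f)) = sform (moment G extension) f f"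
  proof (rule linear_functional_mult_star[OF fin extension_linear _ f])
    show "path_comb.subspace (path_algebra G)"
      unfolding path_algebra_def by (rule subspace_keys)
    fix x y assume "x \<in> Poly_Mapping.keys f" "y \<in> Poly_Mapping.keys f"
    with f have "path_mult G x (path_star G y) \<in> path_algebra_upto G (path_length x + path_length y)"
      by (intro path_mult_star_in[OF fin]) (auto simp: path_algebra_def)
    then show "path_mult G x (path_star G y) \<in> path_algebra G"
      using path_algebra_upto_subset by blast
  qed
  also have "\<dots> = form (lin_ext represent f) (lin_ext represent f)"
    unfolding sform_lin_ext using f
    by (intro sform_cong moment_extension) (auto simp: path_algebra_def)
  also have "\<dots> \<in> \<real>\<^sub>\<ge>\<^sub>0"
    using f by (intro nonneg lin_ext_represent_upto) auto
  finally show "extension (alg_mult G f (alg_star G f)) \<in> \<real>\<^sub>\<ge>\<^sub>0" .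
qed

text \<open>A path of length at most \<open>2 * d\<close> is cut into \<open>y z\<close> with both
  halves of length at most \<open>d\<close>. Then \<open>y\<close> and the star of \<open>z\<close>
  represent themselves, and their pairing is \<open>L\<close> of the path.\<close>

lemma L_represent:
  assumes "x \<in> paths G" "path_length x \<le> 2 * d"
  shows "L (represent x) = L (Poly_Mapping.single x 1)"
proof -
  define y where "y = (fst x, take d (snd x))"
  define z where "z = (path_end G y, drop d (snd x))"
  have y: "y \<in> paths G" "path_length y \<le> d" and z: "z \<in> paths G" "path_length z \<le> d"
    using assms paths_append_iff[OF fin, of "fst x" "take d (snd x)" "drop d (snd x)"]
    by (simp_all add: y_def z_def path_length_def)
  have star: "path_star G z \<in> paths G" "path_length (path_star G z) \<le> d"
    "path_end G (path_star G z) = path_end G y" "path_star G (path_star G z) = z"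
    using path_star_in_paths[OF fin z(1)] z(2)
    by (simp_all add: path_length_def path_star_def z_def)
  have x: "(fst y, snd y @ snd z) = x" by (simp add: y_def z_def)
  have "L (represent x) = form (represent y) (represent (path_star G z))"
    using form_represent[OF y(1) star(1)] star(3,4) x by simp
  also have "\<dots> = moment G L y (path_star G z)"
    by (simp only: represent_short y star sform_single)
  also have "\<dots> = L (Poly_Mapping.single x 1)"
    unfolding moment_def star(4) using x by (simp add: path_mult_def z_def)
  finally show ?thesis .
qed

lemma extension_extends: "extends_on (path_algebra_upto G (2 * d)) extension L"
  unfolding extends_on_def
proof
  fix f assume "f \<in> path_algebra_upto G (2 * d)"
  then have f: "x \<in> paths G" "path_length x \<le> 2 * d" if "x \<in> Poly_Mapping.keys f" for x
    using that by (auto simp: path_algebra_upto_iff)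
  have "extension f = (\<Sum>x\<in>Poly_Mapping.keys f. Poly_Mapping.lookup f x * L (represent x))"
    unfolding extension_def
    by (rule linear_functional_on_lin_ext[OF linear subspace_upto]) (simp add: f represent_upto)
  also have "\<dots> = (\<Sum>x\<in>Poly_Mapping.keys f.
      Poly_Mapping.lookup f x * L (Poly_Mapping.single x 1))"
    by (simp add: f L_represent)
  also have "\<dots> = L (lin_ext (\<lambda>x. Poly_Mapping.single x 1) f)"
    by (rule linear_functional_on_lin_ext[OF linear subspace_upto, symmetric])
       (use f in \<open>fastforce simp: path_algebra_upto_iff\<close>)
  finally show "extension f = L f" by simp
qed

end

theorem corollary5:
  fixes G :: "('v, 'e) pre_digraph"
    and d :: nat
    and L\<^sub>d :: "('v, 'e) path_comb \<Rightarrow> complex"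
  assumes "fin_digraph G"
    and "linear_functional_on (path_algebra_upto G (2 * d)) L\<^sub>d"
  shows "(\<exists>L. positive_functional G L \<and> extends_on (path_algebra_upto G (2 * d)) L L\<^sub>d) \<longleftrightarrow>
         (\<exists>L'. positive_functional_upto G (d + 1) L' \<and>
               extends_on (path_algebra_upto G (2 * d)) L' L\<^sub>d)"
proof
  assume "\<exists>L. positive_functional G L \<and> extends_on (path_algebra_upto G (2 * d)) L L\<^sub>d"
  then obtain L where L: "positive_functional G L"
    and ext: "extends_on (path_algebra_upto G (2 * d)) L L\<^sub>d" by blast
  \<comment> \<open>Restriction suffices: both truncated spaces lie in the whole algebra.\<close>
  from L have "positive_functional_upto G (d + 1) L"
    using path_algebra_upto_subset[of G]
    unfolding positive_functional_def positive_functional_upto_def linear_functional_on_def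
    by blast
  with ext show "\<exists>L'. positive_functional_upto G (d + 1) L' \<and>
      extends_on (path_algebra_upto G (2 * d)) L' L\<^sub>d" by blast
next
  assume "\<exists>L'. positive_functional_upto G (d + 1) L' \<and>
      extends_on (path_algebra_upto G (2 * d)) L' L\<^sub>d"
  then obtain L' where L': "positive_functional_upto G (d + 1) L'"
    and ext: "extends_on (path_algebra_upto G (2 * d)) L' L\<^sub>d" by blast
  interpret truncated_functional G d L'
    using assms(1) L' by (rule truncated_functional.intro)
  have "extends_on (path_algebra_upto G (2 * d)) extension L\<^sub>d"
    using extension_extends ext by (simp add: extends_on_def)
  with extension_positive
  show "\<exists>L. positive_functional G L \<and> extends_on (path_algebra_upto G (2 * d)) L L\<^sub>d" by blast
qed

end
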